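(* Let $I$ be a finite set and let $T$ be a tree on $I$ with associated partial order $\leq_T$. Let $H_T$ be the central hyperplane arrangement in $\mathbb{C}^I$ (with coordinates $x_i$, $i\in I$) consisting of the hyperplanes $x_i=x_j$ for all $i,j\in I$ with $i<_T j$. Then the arrangement $H_T$ is free, and its exponents (as a multiset) are the depths $\operatorname{Depth}(i)$ of the vertices $i\in I$ of $T$.
   Context: A tree on a finite set $I$ is a labeled rooted tree with vertex set $I$; equivalently, a partial order $\leq_T$ on $I$ with a unique minimal element (the root) such that the interval between the root and any element of $I$ is a chain. The depth $\operatorname{Depth}(i)$ of a vertex $i$ is the number of edges in the maximal chain from the root to $i$, i.e. the number of $k\in I$ with $k<_T i$. $\operatorname{Der}(H_T)$ is the module, over the polynomial ring $\mathbb{C}[x_i : i\in I]$, of polynomial vector fields $\theta$ on $\mathbb{C}^I$ such that $\alpha$ divides $\theta(\alpha)$ for each linear form $\alpha=x_i-x_j$ with $i<_T j$. The arrangement is free (in the sense of Saito) if $\operatorname{Der}(H_T)$ is a free module over the polynomial ring; then it has a basis of homogeneous vector fields, and the exponents are the polynomial degrees of the coefficients of these basis elements (so $\partial/\partial x_i$ contributes exponent $0$ and the Euler field contributes exponent $1$). *)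

theory Defs
  imports "HOL-Analysis.Analysis" "HOL-Library.Poly_Mapping" "HOL-Library.Multiset"
begin

text \<open>
  The polynomial ring \<open>\<complex>[x_i : i \<in> I]\<close>, where the finite set \<open>I\<close> is the universe of a finite type
  \<open>'i\<close>: a polynomial maps exponent vectors to coefficients.
\<close>

type_synonym 'i cpoly = "('i \<Rightarrow>\<^sub>0 nat) \<Rightarrow>\<^sub>0 complex"

text \<open>A vector field \<open>\<Sum>i. f_i \<partial>/\<partial>x_i\<close> on \<open>\<complex>^I\<close> is the vector of its coefficients \<open>f_i\<close>.\<close>

type_synonym 'i vfield = "('i cpoly) ^ 'i"

interpretation vf: module "(*s) :: 'i::finite cpoly \<Rightarrow> 'i vfield \<Rightarrow> 'i vfield"
  by unfold_locales (simp_all add: vec_eq_iff algebra_simps)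

text \<open>
  If \<open>x_i\<close> does not occur in the monomial \<open>m\<close>, the subtraction truncates, but then the
  coefficient is zero.
\<close>

definition partial_deriv :: "'i \<Rightarrow> 'i cpoly \<Rightarrow> 'i cpoly" where
  "partial_deriv i p =
     (\<Sum>m\<in>Poly_Mapping.keys p.
        Poly_Mapping.single (m - Poly_Mapping.single i 1)
          (of_nat (Poly_Mapping.lookup m i) * Poly_Mapping.lookup p m))"

definition vf_apply :: "'i::finite vfield \<Rightarrow> 'i cpoly \<Rightarrow> 'i cpoly" where
  "vf_apply \<theta> p = (\<Sum>i\<in>UNIV. \<theta> $ i * partial_deriv i p)"

definition homogeneous_poly :: "nat \<Rightarrow> 'i::finite cpoly \<Rightarrow> bool" where
  "homogeneous_poly d p \<longleftrightarrow>
     (\<forall>m\<in>Poly_Mapping.keys p. (\<Sum>i\<in>UNIV. Poly_Mapping.lookup m i) = d)"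

definition homogeneous_vf :: "nat \<Rightarrow> 'i::finite vfield \<Rightarrow> bool" where
  "homogeneous_vf d \<theta> \<longleftrightarrow> (\<forall>i. homogeneous_poly d (\<theta> $ i))"

definition coord :: "'i \<Rightarrow> 'i cpoly" where
  "coord i = Poly_Mapping.single (Poly_Mapping.single i 1) 1"

definition linear_form :: "complex ^ 'i \<Rightarrow> 'i::finite cpoly" where
  "linear_form a = (\<Sum>k\<in>UNIV. Poly_Mapping.single 0 (a $ k) * coord k)"

definition kernel_hyperplane :: "complex ^ 'i::finite \<Rightarrow> (complex ^ 'i) set" where
  "kernel_hyperplane a = {v. (\<Sum>k\<in>UNIV. a $ k * v $ k) = 0}"

text \<open>
  A central arrangement is a set of linear hyperplanes in \<open>\<complex>^I\<close>. Its module of derivations is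
  defined using all linear forms whose kernel belongs to the arrangement; two forms with the same
  kernel differ by a nonzero scalar, so one form for each hyperplane gives the same module (see
  \<open>der_tree_arrangement\<close> below).
\<close>

definition Der :: "(complex ^ 'i) set set \<Rightarrow> 'i::finite vfield set" where
  "Der A = {\<theta>. \<forall>a. a \<noteq> 0 \<and> kernel_hyperplane a \<in> A
                     \<longrightarrow> linear_form a dvd vf_apply \<theta> (linear_form a)}"

definition is_basis_of :: "'i::finite vfield set \<Rightarrow> 'i vfield set \<Rightarrow> bool" where
  "is_basis_of B D \<longleftrightarrow> vf.independent B \<and> vf.span B = D"

definition free_arrangement :: "(complex ^ 'i::finite) set set \<Rightarrow> bool" where
  "free_arrangement A \<longleftrightarrow> (\<exists>B. is_basis_of B (Der A))"

text \<open>
  \<open>M\<close> is the multiset of degrees of some homogeneous basis of \<open>Der A\<close>. Basis elements are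
  nonzero, so their degree \<open>d \<theta>\<close> is determined.
\<close>

definition has_exponents :: "(complex ^ 'i::finite) set set \<Rightarrow> nat multiset \<Rightarrow> bool" where
  "has_exponents A M \<longleftrightarrow>
     (\<exists>B d. finite B \<and> is_basis_of B (Der A) \<and> (\<forall>\<theta>\<in>B. homogeneous_vf (d \<theta>) \<theta>)
            \<and> M = image_mset d (mset_set B))"

text \<open>A rooted tree on the universe of \<open>'i\<close>, as the partial order it induces on its vertices.\<close>

definition minimal_vertex :: "'i rel \<Rightarrow> 'i \<Rightarrow> bool" where
  "minimal_vertex T r \<longleftrightarrow> (\<forall>k. (k, r) \<in> T \<longrightarrow> k = r)"

definition tree_order :: "'i rel \<Rightarrow> bool" where
  "tree_order T \<longleftrightarrow> partial_order_on UNIV T \<and> (\<exists>!r. minimal_vertex T r) \<and>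
     (\<forall>r i. minimal_vertex T r \<longrightarrow> {k. (r, k) \<in> T \<and> (k, i) \<in> T} \<in> Chains T)"

definition depth :: "'i rel \<Rightarrow> 'i \<Rightarrow> nat" where
  "depth T i = card {k. (k, i) \<in> T \<and> k \<noteq> i}"

definition tree_arrangement :: "'i rel \<Rightarrow> (complex ^ 'i::finite) set set" where
  "tree_arrangement T = {{v. v $ i = v $ j} | i j. (i, j) \<in> T \<and> i \<noteq> j}"


lemma partial_deriv_superset:
  assumes "finite S" "Poly_Mapping.keys p \<subseteq> S"
  shows "partial_deriv i p = (\<Sum>m\<in>S. Poly_Mapping.single (m - Poly_Mapping.single i 1)
           (of_nat (Poly_Mapping.lookup m i) * Poly_Mapping.lookup p m))"
  unfolding partial_deriv_def
  by (rule sum.mono_neutral_left) (use assms in \<open>auto simp: in_keys_iff\<close>)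

lemma partial_deriv_add: "partial_deriv i (p + q) = partial_deriv i p + partial_deriv i q"
proof -
  let ?S = "Poly_Mapping.keys p \<union> Poly_Mapping.keys q"
  have "Poly_Mapping.keys (p + q) \<subseteq> ?S" by (rule Poly_Mapping.keys_add)
  then show ?thesis
    by (simp add: partial_deriv_superset[of ?S] lookup_add algebra_simps single_add sum.distrib)
qed

lemma partial_deriv_0 [simp]: "partial_deriv i 0 = 0"
  by (simp add: partial_deriv_def)

lemma partial_deriv_single:
  "partial_deriv i (Poly_Mapping.single m c) =
     Poly_Mapping.single (m - Poly_Mapping.single i 1) (of_nat (Poly_Mapping.lookup m i) * c)"
  by (simp add: partial_deriv_def)

lemma partial_deriv_sum: "partial_deriv i (sum f A) = (\<Sum>k\<in>A. partial_deriv i (f k))"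
  by (induction A rule: infinite_finite_induct) (simp_all add: partial_deriv_add)

lemma partial_deriv_linear_form:
  "partial_deriv i (linear_form a) = Poly_Mapping.single 0 (a $ i)"
proof -
  have "partial_deriv i (Poly_Mapping.single 0 (a $ k) * coord k) =
      (if k = i then Poly_Mapping.single 0 (a $ i) else 0)" for k
    by (auto simp: coord_def mult_single partial_deriv_single lookup_single)
  then show ?thesis
    by (simp add: linear_form_def partial_deriv_sum)
qed

lemma vf_apply_linear_form:
  "vf_apply \<theta> (linear_form a) = (\<Sum>i\<in>UNIV. Poly_Mapping.single 0 (a $ i) * \<theta> $ i)"
  by (simp add: vf_apply_def partial_deriv_linear_form mult.commute)

lemma single_0_mult_left:
  fixes q :: "'i cpoly"
  shows "Poly_Mapping.single 0 (c * x) * q =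
    Poly_Mapping.single 0 c * (Poly_Mapping.single 0 x * q)"
  by (simp add: mult_single mult.assoc[symmetric])

lemma linear_form_scale:
  "linear_form (c *s a) = Poly_Mapping.single 0 c * linear_form a"
  by (simp add: linear_form_def sum_distrib_left single_0_mult_left)

lemma linear_form_diff_axis:
  fixes i j :: "'i::finite"
  shows "linear_form (axis i 1 - axis j 1) = coord i - coord j"
proof -
  have "Poly_Mapping.single 0 ((axis i 1 - axis j 1 :: complex ^ 'i) $ k) * coord k =
      (if k = i then coord i else 0) - (if k = j then coord j else (0 :: 'i cpoly))" for k
    by (auto simp: axis_def single_diff)
  then show ?thesis
    by (simp add: linear_form_def sum_subtractf)
qed

lemma vf_apply_diff_axis:
  fixes i j :: "'i::finite"
  shows "vf_apply \<theta> (coord i - coord j) = \<theta> $ i - \<theta> $ j"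
proof -
  have "Poly_Mapping.single 0 ((axis i 1 - axis j 1 :: complex ^ 'i) $ k) * \<theta> $ k =
      (if k = i then \<theta> $ i else 0) - (if k = j then \<theta> $ j else (0 :: 'i cpoly))" for k
    by (auto simp: axis_def single_diff)
  then show ?thesis
    by (simp add: linear_form_diff_axis[symmetric] vf_apply_linear_form sum_subtractf)
qed

lemma kernel_hyperplane_diff_axis:
  fixes i j :: "'i::finite"
  shows "kernel_hyperplane (axis i 1 - axis j 1) = {v. v $ i = v $ j}"
proof -
  have "(axis i 1 - axis j 1 :: complex ^ 'i) $ k * v $ k =
      (if k = i then v $ i else 0) - (if k = j then v $ j else 0)" for k and v :: "complex ^ 'i"
    by (auto simp: axis_def)
  then show ?thesis
    by (simp add: kernel_hyperplane_def sum_subtractf)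
qed

lemma kernel_hyperplane_eq_diagonal:
  fixes a :: "complex ^ 'i::finite"
  assumes "kernel_hyperplane a = {v. v $ i = v $ j}" "i \<noteq> j"
  shows "a = a $ i *s (axis i 1 - axis j 1)"
proof -
  have dot: "(\<Sum>l\<in>UNIV. a $ l * axis k 1 $ l) = a $ k" for k
  proof -
    have "(\<Sum>l\<in>UNIV. a $ l * axis k 1 $ l) = (\<Sum>l\<in>UNIV. if l = k then a $ k else 0)"
      by (rule sum.cong) (auto simp: axis_def)
    then show ?thesis by simp
  qed
  have "a $ k = 0" if "k \<noteq> i" "k \<noteq> j" for k
  proof -
    have "axis k 1 \<in> kernel_hyperplane a"
      using that unfolding assms(1) by (simp add: axis_def)
    then show ?thesis by (simp add: kernel_hyperplane_def dot)
  qed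
  moreover have "a $ i + a $ j = 0"
  proof -
    have "axis i 1 + axis j 1 \<in> kernel_hyperplane a"
      using assms(2) unfolding assms(1) by (simp add: axis_def)
    then show ?thesis
      by (simp add: kernel_hyperplane_def distrib_left sum.distrib dot)
  qed
  ultimately show ?thesis
    using assms(2) by (auto simp: vec_eq_iff axis_def add_eq_0_iff)
qed

text \<open>For \<open>H_T\<close>, only the forms \<open>x_i - x_j\<close> with \<open>i\<close> strictly below \<open>j\<close> need to be tested.\<close>

lemma der_tree_arrangement:
  fixes T :: "'i::finite rel"
  shows "Der (tree_arrangement T) =
    {\<theta>. \<forall>i j. (i, j) \<in> T \<and> i \<noteq> j \<longrightarrow>
       (coord i - coord j) dvd vf_apply \<theta> (coord i - coord j)}"
    (is "?L = ?R")
proof (rule Set.equalityI; rule subsetI)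
  fix \<theta> assume \<theta>: "\<theta> \<in> ?L"
  show "\<theta> \<in> ?R"
  proof (clarify)
    fix i j assume ij: "(i, j) \<in> T" "i \<noteq> j"
    let ?a = "axis i 1 - axis j 1 :: complex ^ 'i"
    have "?a $ i \<noteq> 0" using ij by (simp add: axis_def)
    then have "?a \<noteq> 0" by force
    moreover have "kernel_hyperplane ?a \<in> tree_arrangement T"
      unfolding kernel_hyperplane_diff_axis tree_arrangement_def using ij by blast
    ultimately have "linear_form ?a dvd vf_apply \<theta> (linear_form ?a)"
      using \<theta> unfolding Der_def by blast
    then show "(coord i - coord j) dvd vf_apply \<theta> (coord i - coord j)"
      by (simp only: linear_form_diff_axis)
  qed
next
  fix \<theta> assume \<theta>: "\<theta> \<in> ?R"
  show "\<theta> \<in> ?L"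
    unfolding Der_def
  proof (clarify)
    fix a :: "complex ^ 'i"
    assume "a \<noteq> 0" "kernel_hyperplane a \<in> tree_arrangement T"
    then obtain i j where ij: "(i, j) \<in> T" "i \<noteq> j" "kernel_hyperplane a = {v. v $ i = v $ j}"
      by (auto simp: tree_arrangement_def)
    define b :: "complex ^ 'i" where "b = axis i 1 - axis j 1"
    define c where "c = a $ i"
    have a: "a = c *s b"
      using kernel_hyperplane_eq_diagonal[OF ij(3,2)] by (simp add: b_def c_def)
    with \<open>a \<noteq> 0\<close> have "c \<noteq> 0" by auto
    then have unit: "Poly_Mapping.single 0 c * Poly_Mapping.single 0 (inverse c) = (1 :: 'i cpoly)"
      by (simp add: mult_single)
    have "linear_form b dvd vf_apply \<theta> (linear_form b)"
      using \<theta> ij unfolding b_def linear_form_diff_axis by blast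
    moreover have "vf_apply \<theta> (linear_form a) = Poly_Mapping.single 0 c * vf_apply \<theta> (linear_form b)"
      by (simp add: vf_apply_linear_form a sum_distrib_left single_0_mult_left)
    ultimately show "linear_form a dvd vf_apply \<theta> (linear_form a)"
      by (simp add: a linear_form_scale mult_dvd_mono)
  qed
qed

lemma subspace_Der: "vf.subspace (Der A)"
proof -
  have "vf_apply 0 p = 0" for p :: "'a cpoly" by (simp add: vf_apply_def)
  moreover have "vf_apply (\<theta> + \<eta>) p = vf_apply \<theta> p + vf_apply \<eta> p" for \<theta> \<eta> and p :: "'a cpoly"
    by (simp add: vf_apply_def algebra_simps sum.distrib)
  moreover have "vf_apply (f *s \<theta>) p = f * vf_apply \<theta> p" for f \<theta> and p :: "'a cpoly"
    by (simp add: vf_apply_def sum_distrib_left mult.assoc)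
  ultimately show ?thesis
    unfolding vf.subspace_def Der_def by auto
qed

end

theory Submission
  imports Defs
begin

text \<open>
  For a vertex \<open>i\<close>, let \<open>\<theta>\<^sub>i\<close> be the vector field whose \<open>k\<close>-th coefficient is \<open>\<Prod>(x\<^sub>k - x\<^sub>l)\<close> over
  \<open>l < i\<close> if \<open>i \<le> k\<close>, and \<open>0\<close> otherwise; it is homogeneous of degree the depth of \<open>i\<close>. It lies in
  the module of derivations because the vertices below a given one form a chain, and these fields
  are independent because they are triangular with respect to the tree order. They span: if \<open>i\<close> is
  minimal with \<open>\<theta>(x\<^sub>i) \<noteq> 0\<close>, then each of the coprime forms \<open>x\<^sub>i - x\<^sub>l\<close> with \<open>l < i\<close> divides
  \<open>\<theta>(x\<^sub>i)\<close>, so a multiple of \<open>\<theta>\<^sub>i\<close> can be subtracted to make the coefficient at \<open>i\<close> vanish. The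
  degrees of a homogeneous basis do not depend on the basis, by a trace argument.
\<close>

section \<open>Substitution of polynomials for the variables\<close>

lemma cpoly_eq_sum_singles:
  fixes p :: "'i cpoly"
  shows "p = (\<Sum>m\<in>Poly_Mapping.keys p. Poly_Mapping.single m (Poly_Mapping.lookup p m))"
  by (rule poly_mapping_eqI)
     (auto simp: lookup_sum lookup_single when_def in_keys_iff sum.delta' 
        Poly_Mapping.finite_keys)

text \<open>Serves two substitutions: setting \<open>x_i\<close> equal to \<open>x_j\<close>, which
  tests divisibility by \<open>x_i - x_j\<close>, and doubling all variables, which detects
  degrees.\<close>

definition poly_subst :: "('i::finite \<Rightarrow> 'i cpoly) \<Rightarrow> 'i cpoly \<Rightarrow> 'i cpoly" where
  "poly_subst f p =
     (\<Sum>m\<in>Poly_Mapping.keys p.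
        Poly_Mapping.single 0 (Poly_Mapping.lookup p m) * (\<Prod>i\<in>UNIV. f i ^ Poly_Mapping.lookup m i))"

lemma poly_subst_superset:
  assumes "finite S" "Poly_Mapping.keys p \<subseteq> S"
  shows "poly_subst f p =
    (\<Sum>m\<in>S. Poly_Mapping.single 0 (Poly_Mapping.lookup p m) * (\<Prod>i\<in>UNIV. f i ^ Poly_Mapping.lookup m i))"
  unfolding poly_subst_def
  by (rule sum.mono_neutral_left) (use assms in \<open>auto simp: in_keys_iff\<close>)

lemma poly_subst_add: "poly_subst f (p + q) = poly_subst f p + poly_subst f q"
proof -
  let ?S = "Poly_Mapping.keys p \<union> Poly_Mapping.keys q"
  have "Poly_Mapping.keys (p + q) \<subseteq> ?S" by (rule Poly_Mapping.keys_add)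
  then show ?thesis
    by (simp add: poly_subst_superset[of ?S] lookup_add algebra_simps single_add sum.distrib)
qed

lemma poly_subst_0 [simp]: "poly_subst f 0 = 0"
  by (simp add: poly_subst_def)

lemma poly_subst_sum: "poly_subst f (sum g A) = (\<Sum>k\<in>A. poly_subst f (g k))"
  by (induction A rule: infinite_finite_induct) (simp_all add: poly_subst_add)

lemma poly_subst_diff: "poly_subst f (p - q) = poly_subst f p - poly_subst f q"
  using poly_subst_add[of f "p - q" q] by simp

lemma poly_subst_single:
  "poly_subst f (Poly_Mapping.single m c) =
     Poly_Mapping.single 0 c * (\<Prod>i\<in>UNIV. f i ^ Poly_Mapping.lookup m i)"
  by (simp add: poly_subst_def)

lemma poly_subst_mult:
  fixes f :: "'i::finite \<Rightarrow> 'i cpoly"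
  shows "poly_subst f (p * q) = poly_subst f p * poly_subst f q"
proof -
  have single: "poly_subst f (Poly_Mapping.single m c * Poly_Mapping.single n d) =
      poly_subst f (Poly_Mapping.single m c) * poly_subst f (Poly_Mapping.single n d)" for m n c d
  proof -
    have "Poly_Mapping.single 0 (c * d) = Poly_Mapping.single 0 c * (Poly_Mapping.single 0 d :: 'i cpoly)"
      by (simp add: mult_single)
    note const = this
    show ?thesis
      unfolding mult_single poly_subst_single lookup_add power_add prod.distrib
      by (simp add: const mult_ac)
  qed
  \<comment> \<open>Sums of general monomial families are used because the expansion of
    \<open>p\<close> into monomials mentions \<open>p\<close> again and so would loop as a rewrite
    rule; it is only folded back at the end.\<close>
  have "poly_subst f (sum g A * sum h B) = poly_subst f (sum g A) * poly_subst f (sum h B)"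
    if "\<And>m. g m = Poly_Mapping.single m (c m)" "\<And>m. h m = Poly_Mapping.single m (d m)" for g h A B c d
    by (simp add: sum_product poly_subst_sum single that)
  from this[OF refl refl, of "Poly_Mapping.lookup p" "Poly_Mapping.keys p"
      "Poly_Mapping.lookup q" "Poly_Mapping.keys q"] show ?thesis
    by (simp only: cpoly_eq_sum_singles[symmetric])
qed

lemma poly_subst_coord [simp]: "poly_subst f (coord i) = f i"
proof -
  have "f k ^ Poly_Mapping.lookup (Poly_Mapping.single i (1::nat)) k = (if k = i then f i else 1)" for k
    by (auto simp: lookup_single)
  then show ?thesis
    by (simp add: coord_def poly_subst_single)
qed

lemma prod_coord_power:
  "(\<Prod>i\<in>UNIV. coord i ^ Poly_Mapping.lookup m i) = Poly_Mapping.single (m :: 'i::finite \<Rightarrow>\<^sub>0 nat) 1"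
proof -
  have pow: "coord i ^ n = Poly_Mapping.single (Poly_Mapping.single i n) 1" for i :: 'i and n
    by (induction n) (simp_all add: coord_def mult_single single_add[symmetric])
  have "(\<Prod>i\<in>A. coord i ^ Poly_Mapping.lookup m i) =
      Poly_Mapping.single (\<Sum>i\<in>A. Poly_Mapping.single i (Poly_Mapping.lookup m i)) 1"
    for A :: "'i set"
    by (induction A rule: infinite_finite_induct) (simp_all add: pow mult_single)
  moreover have "(\<Sum>i\<in>UNIV. Poly_Mapping.single i (Poly_Mapping.lookup m i)) = m"
    by (rule poly_mapping_eqI) (simp add: lookup_sum lookup_single when_def)
  ultimately show ?thesis by simp
qed

lemma poly_subst_id: "poly_subst coord p = p"
  by (subst (2) cpoly_eq_sum_singles[of p])
     (simp add: poly_subst_def prod_coord_power mult_single)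

section \<open>Divisibility by differences of coordinates\<close>

lemma diff_dvd_swap:
  fixes a b c :: "'b::comm_ring_1"
  shows "a - b dvd c \<longleftrightarrow> b - a dvd c"
  using minus_dvd_iff[of "a - b" c] by simp

text \<open>Telescoping: the factors are exchanged one at a time.\<close>

lemma prod_diff_dvd:
  fixes f g :: "'a \<Rightarrow> 'b::comm_ring_1"
  assumes "\<And>i. i \<in> A \<Longrightarrow> x dvd f i - g i"
  shows "x dvd prod f A - prod g A"
  using assms
proof (induction A rule: infinite_finite_induct)
  case (insert a A)
  have "prod f (insert a A) - prod g (insert a A) = f a * (prod f A - prod g A) + (f a - g a) * prod g A"
    using insert by (simp add: algebra_simps)
  then show ?case using insert by (simp add: dvd_add dvd_mult dvd_mult2)
qed auto

lemma power_diff_dvd: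
  fixes a b :: "'b::comm_ring_1"
  shows "a - b dvd a ^ n - b ^ n"
  using prod_diff_dvd[of "{..<n}" "a - b" "\<lambda>_. a" "\<lambda>_. b"] by simp

lemma poly_subst_diff_dvd:
  assumes "\<And>i. x dvd f i - g i"
  shows "x dvd poly_subst f p - poly_subst g p"
proof -
  have "x dvd (\<Prod>i\<in>UNIV. f i ^ Poly_Mapping.lookup m i) - (\<Prod>i\<in>UNIV. g i ^ Poly_Mapping.lookup m i)" for m
    by (rule prod_diff_dvd) (rule dvd_trans[OF assms power_diff_dvd])
  then show ?thesis
    unfolding poly_subst_def sum_subtractf[symmetric] right_diff_distrib[symmetric]
    by (intro dvd_sum dvd_mult)
qed

text \<open>Factor theorem. The substitution kills \<open>x_i - x_j\<close>; conversely, it changes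
  \<open>p\<close> only by a multiple of \<open>x_i - x_j\<close>, since the two substitutions
  \<open>coord\<close> and \<open>coord(i := coord j)\<close> are congruent modulo that
  form.\<close>

lemma coord_diff_dvd_iff:
  "coord i - coord j dvd p \<longleftrightarrow> poly_subst (coord(i := coord j)) p = 0"
proof
  assume "coord i - coord j dvd p"
  then obtain q where "p = (coord i - coord j) * q" by (elim dvdE)
  then show "poly_subst (coord(i := coord j)) p = 0"
    by (simp add: poly_subst_mult poly_subst_diff)
next
  have "coord i - coord j dvd poly_subst coord p - poly_subst (coord(i := coord j)) p"
    by (rule poly_subst_diff_dvd) auto
  then show "coord i - coord j dvd p" if "poly_subst (coord(i := coord j)) p = 0"
    by (simp add: poly_subst_id that)
qed

lemma coord_mult:
  "coord i * p = (\<Sum>m\<in>Poly_Mapping.keys p. Poly_Mapping.single (Poly_Mapping.single i 1 + m) (Poly_Mapping.lookup p m))"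
  by (subst (1) cpoly_eq_sum_singles[of p]) (simp add: coord_def sum_distrib_left mult_single)

text \<open>
  The library's integral domain instance for polynomial mappings needs a linear order on the
  exponent vectors, which an unordered index type does not provide.
\<close>

lemma coord_diff_mult_eq_0:
  fixes p :: "'i::finite cpoly"
  assumes "i \<noteq> j" "(coord i - coord j) * p = 0"
  shows "p = 0"
proof (rule ccontr)
  assume "p \<noteq> 0"
  define deg where "deg m = Poly_Mapping.lookup m i" for m :: "'i \<Rightarrow>\<^sub>0 nat"
  have ne: "Poly_Mapping.keys p \<noteq> {}" using \<open>p \<noteq> 0\<close> by simp
  have "Max (deg ` Poly_Mapping.keys p) \<in> deg ` Poly_Mapping.keys p"
    using ne by (intro Max_in) auto
  then obtain n where n: "n \<in> Poly_Mapping.keys p" "deg n = Max (deg ` Poly_Mapping.keys p)"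
    by auto
  then have n_max: "deg m \<le> deg n" if "m \<in> Poly_Mapping.keys p" for m
    using that by simp
  \<comment> \<open>As \<open>n\<close> has maximal degree in \<open>x_i\<close>, the monomial
    \<open>x_i * n\<close> has larger degree in \<open>x_i\<close> than any monomial of
    \<open>x_j * p\<close>, so nothing can cancel it.\<close>
  let ?k = "Poly_Mapping.single i 1 + n"
  have "Poly_Mapping.lookup (coord i * p) ?k = Poly_Mapping.lookup p n"
    using n(1) by (simp add: coord_mult lookup_sum lookup_single when_def)
  moreover have "Poly_Mapping.lookup (coord j * p) ?k = 0"
  proof -
    have "Poly_Mapping.single j 1 + m \<noteq> ?k" if "m \<in> Poly_Mapping.keys p" for m
    proof
      assume "Poly_Mapping.single j 1 + m = ?k"
      then have "deg (Poly_Mapping.single j 1 + m) = deg ?k" by simp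
      then have "deg m = Suc (deg n)" using assms(1) by (simp add: deg_def lookup_add lookup_single)
      then show False using n_max[OF that] by simp
    qed
    then show ?thesis
      by (simp add: coord_mult lookup_sum lookup_single when_def)
  qed
  ultimately have "Poly_Mapping.lookup ((coord i - coord j) * p) ?k = Poly_Mapping.lookup p n"
    by (simp add: algebra_simps lookup_minus)
  then show False using assms(2) n(1) by (simp add: in_keys_iff)
qed

lemma prod_coord_diff_mult_eq_0:
  fixes p :: "'i::finite cpoly"
  assumes "i \<notin> A" "(\<Prod>l\<in>A. coord i - coord l) * p = 0"
  shows "p = 0"
proof -
  have "finite A" by simp
  then show ?thesis using assms
    by (induction A) (auto simp: mult.assoc dest: coord_diff_mult_eq_0)
qed

text \<open>Replaces an appeal to unique factorization: the forms are split off one by one, and the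
  factor theorem shows that the remaining ones still divide the quotient.\<close>

lemma prod_coord_diff_dvd:
  fixes p :: "'i::finite cpoly"
  assumes "i \<notin> A" "\<And>l. l \<in> A \<Longrightarrow> coord i - coord l dvd p"
  shows "(\<Prod>l\<in>A. coord i - coord l) dvd p"
proof -
  have "finite A" by simp
  then show ?thesis using assms
  proof (induction A arbitrary: p)
    case (insert a A)
    obtain q where q: "p = (coord i - coord a) * q" using insert.prems by (meson dvdE insertI1)
    have "coord i - coord l dvd q" if "l \<in> A" for l
    proof -
      \<comment> \<open>Setting \<open>x_i = x_l\<close> in \<open>p = (x_i - x_a) * q\<close> gives
        zero, and turns the first factor into \<open>x_l - x_a\<close>, which can be
        cancelled.\<close>
      have "(coord l - coord a) * poly_subst (coord(i := coord l)) q = 0"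
        using insert.prems(2)[of l] that insert.prems(1)
        by (auto simp: coord_diff_dvd_iff q poly_subst_mult poly_subst_diff)
      moreover have "l \<noteq> a" using that insert.hyps by auto
      ultimately show ?thesis using coord_diff_mult_eq_0 coord_diff_dvd_iff by blast
    qed
    then have "(\<Prod>l\<in>A. coord i - coord l) dvd q" using insert by auto
    then show ?case using insert.hyps by (simp add: q mult_dvd_mono)
  qed simp
qed

section \<open>Scaling of the variables and evaluation at the origin\<close>

lemma poly_subst_scale_homogeneous:
  assumes "homogeneous_poly d p"
  shows "poly_subst (\<lambda>i. c * coord i) p = c ^ d * p"
proof -
  have "poly_subst (\<lambda>i. c * coord i) p = (\<Sum>m\<in>Poly_Mapping.keys p. c ^ d * Poly_Mapping.single m (Poly_Mapping.lookup p m))"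
    unfolding poly_subst_def
  proof (rule sum.cong)
    fix m assume "m \<in> Poly_Mapping.keys p"
    then have "c ^ d = (\<Prod>i\<in>UNIV. c ^ Poly_Mapping.lookup m i)"
      using assms by (simp add: homogeneous_poly_def power_sum[symmetric])
    then have "Poly_Mapping.single 0 a *
        (\<Prod>i\<in>UNIV. (c * coord i) ^ Poly_Mapping.lookup m i)
        = c ^ d * (Poly_Mapping.single 0 a * Poly_Mapping.single m 1)" for a
      by (simp add: power_mult_distrib prod.distrib prod_coord_power mult_ac)
    also have "Poly_Mapping.single 0 a * Poly_Mapping.single m 1 = Poly_Mapping.single m a" for a :: complex
      by (simp add: mult_single)
    finally show "Poly_Mapping.single 0 (Poly_Mapping.lookup p m) * (\<Prod>i\<in>UNIV. (c * coord i) ^ Poly_Mapping.lookup m i)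
       = c ^ d * Poly_Mapping.single m (Poly_Mapping.lookup p m)" .
  qed simp
  also have "\<dots> = c ^ d * p"
    unfolding sum_distrib_left[symmetric] cpoly_eq_sum_singles[symmetric] ..
  finally show ?thesis .
qed

text \<open>The coefficient at the zero exponent vector is the value at the origin. Its
  multiplicativity lets matrix identities over the polynomial ring be read over the complex
  numbers.\<close>

lemma lookup_mult_0:
  fixes p q :: "'i cpoly"
  shows "Poly_Mapping.lookup (p * q) 0 = Poly_Mapping.lookup p 0 * Poly_Mapping.lookup q 0"
proof -
  have "0 = l + (r :: 'i \<Rightarrow>\<^sub>0 nat) \<longleftrightarrow> l = 0 \<and> r = 0" for l r
    by (metis add.right_neutral add_eq_0_iff_both_eq_0 lookup_add lookup_zero poly_mapping_eqI)
  then have "(Poly_Mapping.lookup q r when 0 = l + r) = ((Poly_Mapping.lookup q r when r = 0) when l = 0)"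
    for l r by (auto simp: when_def)
  then show ?thesis
    by (simp add: lookup_mult Sum_any_when_independent mult_when)
qed

lemma lookup_prod_0:
  fixes g :: "'a \<Rightarrow> 'i cpoly"
  shows "Poly_Mapping.lookup (prod g A) 0 = (\<Prod>a\<in>A. Poly_Mapping.lookup (g a) 0)"
  by (induction A rule: infinite_finite_induct) (simp_all add: lookup_mult_0 lookup_one)

text \<open>A substitution without constant terms fixes the origin.\<close>

lemma lookup_poly_subst_0:
  assumes "\<And>i. Poly_Mapping.lookup (f i) 0 = 0"
  shows "Poly_Mapping.lookup (poly_subst f p) 0 = Poly_Mapping.lookup p 0"
proof -
  have pow: "Poly_Mapping.lookup (f i ^ n) 0 = (if n = 0 then 1 else 0)" for i n
    by (cases n) (simp_all add: lookup_mult_0 lookup_one assms)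
  have prod0: "(\<Prod>i\<in>UNIV. if Poly_Mapping.lookup m i = 0 then 1 else 0) = (if m = 0 then 1 else (0::complex))"
    for m :: "'a \<Rightarrow>\<^sub>0 nat"
  proof (cases "m = 0")
    case False
    then obtain k where "Poly_Mapping.lookup m k \<noteq> 0"
      by (auto simp: poly_mapping_eq_iff fun_eq_iff)
    then have "\<exists>i\<in>UNIV. (if Poly_Mapping.lookup m i = 0 then 1 else (0::complex)) = 0" by auto
    then show ?thesis using False by (simp add: prod_zero)
  qed simp
  show ?thesis
    unfolding poly_subst_def lookup_sum lookup_mult_0 lookup_prod_0 pow prod0
    by (simp add: in_keys_iff if_distrib cong: if_cong)
qed

section \<open>Uniqueness of the degrees of a homogeneous basis\<close>

lemma independent_coeff_eq:
  fixes B :: "'i::finite vfield set"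
  assumes "vf.independent B" "finite B" "(\<Sum>b\<in>B. u b *s b) = (\<Sum>b\<in>B. v b *s b)" "b \<in> B"
  shows "u b = v b"
proof -
  have "(\<Sum>b\<in>B. (u b - v b) *s b) = 0"
    using assms(3) by (simp add: vf.scale_left_diff_distrib sum_subtractf)
  then show ?thesis
    using vf.independentD[OF assms(1,2) order_refl, of "\<lambda>b. u b - v b" b] assms(4) by simp
qed

lemma span_coeffs:
  fixes B C :: "'i::finite vfield set"
  assumes "finite C" "B \<subseteq> vf.span C"
  obtains P where "\<And>b. b \<in> B \<Longrightarrow> b = (\<Sum>c\<in>C. P b c *s c)"
proof -
  have "\<forall>b\<in>B. \<exists>u. b = (\<Sum>c\<in>C. u c *s c)"
    using assms unfolding vf.span_finite[OF assms(1)] by blast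
  from bchoice[OF this] obtain P where "\<forall>b\<in>B. b = (\<Sum>c\<in>C. P b c *s c)" ..
  then show thesis by (intro that[of P]) (rule bspec)
qed

text \<open>A diagonal entry of the product of the two transition matrices; the trace argument adds
  up such entries.\<close>

lemma transition_inverse:
  fixes B C :: "'i::finite vfield set"
  assumes "vf.independent B" "finite B"
    and P: "\<And>b. b \<in> B \<Longrightarrow> b = (\<Sum>c\<in>C. P b c *s c)"
    and Q: "\<And>c. c \<in> C \<Longrightarrow> c = (\<Sum>b\<in>B. Q c b *s b)"
    and "b \<in> B"
  shows "(\<Sum>c\<in>C. P b c * Q c b) = 1"
proof -
  have "(\<Sum>b'\<in>B. (\<Sum>c\<in>C. P b c * Q c b') *s b') = (\<Sum>c\<in>C. P b c *s (\<Sum>b'\<in>B. Q c b' *s b'))"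
    unfolding vf.scale_sum_left vf.scale_sum_right vf.scale_scale by (rule sum.swap)
  also have "\<dots> = b"
    using P[OF assms(5)] Q by simp
  also have "\<dots> = (\<Sum>b'\<in>B. (if b' = b then 1 else 0) *s b')"
    using assms(2,5) by (simp add: if_distrib[of "\<lambda>c. c *s _"] sum.delta cong: if_cong)
  finally have "(\<Sum>c\<in>C. P b c * Q c b) = (if b = b then 1 else 0)"
    by (rule independent_coeff_eq[OF assms(1,2) _ assms(5)])
  then show ?thesis by simp
qed

text \<open>
  The grading is detected by the substitution \<open>x\<^sub>i \<mapsto> 2 x\<^sub>i\<close>: it multiplies a form of degree
  \<open>n\<close> by \<open>2^n\<close> and fixes constant terms.
\<close>

lemma transition_const_nonzero:
  fixes C :: "'i::finite vfield set"
  assumes "vf.independent C" "finite C"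
    and hom: "homogeneous_vf n b" "\<And>c. c \<in> C \<Longrightarrow> homogeneous_vf (e c) c"
    and b: "b = (\<Sum>c\<in>C. u c *s c)"
    and c: "c \<in> C" "Poly_Mapping.lookup (u c) 0 \<noteq> 0"
  shows "e c = n"
proof -
  define \<phi> :: "'i cpoly \<Rightarrow> 'i cpoly" where "\<phi> = poly_subst (\<lambda>i. 2 * coord i)"
  have \<phi>: "\<phi> (\<theta> $ k) = 2 ^ m * \<theta> $ k" if "homogeneous_vf m \<theta>" for m \<theta> k
    using that by (simp add: \<phi>_def homogeneous_vf_def poly_subst_scale_homogeneous)
  have \<phi>0: "Poly_Mapping.lookup (\<phi> p) 0 = Poly_Mapping.lookup p 0" for p
  proof -
    have "Poly_Mapping.single i (1::nat) \<noteq> 0" for i :: 'i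
      by (metis lookup_single_eq lookup_zero one_neq_zero)
    then show ?thesis
      unfolding \<phi>_def
      by (intro lookup_poly_subst_0) (simp add: lookup_mult_0 coord_def lookup_single)
  qed
  \<comment> \<open>Both ends of this chain expand the rescaled field \<open>b\<close> in the basis
    \<open>C\<close>: once by the homogeneity of \<open>b\<close>, once by that of the elements of
    \<open>C\<close>. Coefficients can then be compared.\<close>
  have "(\<Sum>c\<in>C. (2 ^ n * u c) *s c) = 2 ^ n *s b"
    by (simp add: b vf.scale_sum_right)
  also have "\<dots> = (\<chi> k. \<phi> (b $ k))"
    by (simp add: vec_eq_iff \<phi>[OF hom(1)])
  also have "\<dots> = (\<Sum>c\<in>C. (\<phi> (u c) * 2 ^ e c) *s c)"
    unfolding b by (simp add: vec_eq_iff) (simp add: \<phi>_def poly_subst_sum poly_subst_mult \<phi>[OF hom(2), unfolded \<phi>_def] mult.assoc)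
  finally have "2 ^ n * u c = \<phi> (u c) * 2 ^ e c"
    by (rule independent_coeff_eq[OF assms(1,2) _ c(1)])
  then have "Poly_Mapping.lookup (2 ^ n * u c) 0 = Poly_Mapping.lookup (\<phi> (u c) * 2 ^ e c) 0"
    by simp
  moreover have "Poly_Mapping.lookup (2 ^ m :: 'i cpoly) 0 = 2 ^ m" for m
    using lookup_prod_0[of "\<lambda>_. 2 :: 'i cpoly" "{..<m}"]
    by (simp add: lookup_numeral)
  ultimately have "(2::complex) ^ n = 2 ^ e c"
    using c(2) by (simp add: lookup_mult_0 \<phi>0)
  then have "of_nat (2 ^ n) = (of_nat (2 ^ e c) :: complex)" by simp
  then have "(2::nat) ^ n = 2 ^ e c" by (simp only: of_nat_eq_iff)
  then show ?thesis by simp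
qed

text \<open>
  The transition matrices between two homogeneous bases, evaluated at the origin, are inverse to
  each other and vanish between basis elements of different degrees. So they restrict to each
  degree, and the trace of the product of the restrictions counts the basis elements on either side.
\<close>

lemma homogeneous_basis_degrees:
  fixes B C :: "'i::finite vfield set"
  assumes B: "is_basis_of B D" "finite B" "\<And>b. b \<in> B \<Longrightarrow> homogeneous_vf (d b) b"
    and C: "is_basis_of C D" "finite C" "\<And>c. c \<in> C \<Longrightarrow> homogeneous_vf (e c) c"
  shows "image_mset d (mset_set B) = image_mset e (mset_set C)"
proof (rule multiset_eqI)
  fix n
  have indep: "vf.independent B" "vf.independent C" and "B \<subseteq> vf.span C" "C \<subseteq> vf.span B"
    using B(1) C(1) vf.span_superset unfolding is_basis_of_def by blast+
  obtain P where P: "\<And>b. b \<in> B \<Longrightarrow> b = (\<Sum>c\<in>C. P b c *s c)"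
    using span_coeffs[OF C(2) \<open>B \<subseteq> vf.span C\<close>] by blast
  obtain Q where Q: "\<And>c. c \<in> C \<Longrightarrow> c = (\<Sum>b\<in>B. Q c b *s b)"
    using span_coeffs[OF B(2) \<open>C \<subseteq> vf.span B\<close>] by blast
  \<comment> \<open>Row sums of \<open>t\<close> are diagonal entries of \<open>P * Q\<close> at the
    origin, column sums those of \<open>Q * P\<close>. Summing \<open>t\<close> over the block of
    degree \<open>n\<close> in either order therefore counts the basis elements of that
    degree.\<close>
  define t where "t b c = Poly_Mapping.lookup (P b c) 0 * Poly_Mapping.lookup (Q c b) 0" for b c
  have t_B: "(\<Sum>c\<in>C. t b c) = 1" if "b \<in> B" for b
    using arg_cong[OF transition_inverse[OF indep(1) B(2) P Q that], of "\<lambda>p. Poly_Mapping.lookup p 0"]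
    by (simp add: lookup_sum lookup_mult_0 t_def lookup_one)
  have t_C: "(\<Sum>b\<in>B. t b c) = 1" if "c \<in> C" for c
    using arg_cong[OF transition_inverse[OF indep(2) C(2) Q P that], of "\<lambda>p. Poly_Mapping.lookup p 0"]
    by (simp add: lookup_sum lookup_mult_0 t_def lookup_one mult.commute)
  have t_0: "t b c = 0" if "b \<in> B" "c \<in> C" "d b \<noteq> e c" for b c
    using transition_const_nonzero[OF indep(2) C(2) B(3)[OF that(1)] C(3) P[OF that(1)] that(2)] that(3)
    by (auto simp: t_def)
  have "of_nat (card {b\<in>B. d b = n}) = (\<Sum>b\<in>{b\<in>B. d b = n}. \<Sum>c\<in>C. t b c)"
    by (simp add: t_B)
  also have "\<dots> = (\<Sum>b\<in>{b\<in>B. d b = n}. \<Sum>c\<in>{c\<in>C. e c = n}. t b c)"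
    by (rule sum.cong[OF refl], rule sum.mono_neutral_right) (use C(2) in \<open>auto intro!: t_0\<close>)
  also have "\<dots> = (\<Sum>c\<in>{c\<in>C. e c = n}. \<Sum>b\<in>{b\<in>B. d b = n}. t b c)"
    by (rule sum.swap)
  also have "\<dots> = (\<Sum>c\<in>{c\<in>C. e c = n}. \<Sum>b\<in>B. t b c)"
    by (rule sum.cong[OF refl], rule sum.mono_neutral_left) (use B(2) in \<open>auto intro!: t_0\<close>)
  also have "\<dots> = of_nat (card {c\<in>C. e c = n})"
    by (simp add: t_C)
  finally have "card {b\<in>B. d b = n} = card {c\<in>C. e c = n}"
    by (simp only: of_nat_eq_iff)
  then show "count (image_mset d (mset_set B)) n = count (image_mset e (mset_set C)) n"
    using B(2) C(2) by (simp add: count_image_mset' eq_commute[of n] Collect_conj_eq)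
qed

section \<open>The fields attached to the vertices of a tree\<close>

definition tree_field :: "'i rel \<Rightarrow> 'i \<Rightarrow> 'i::finite vfield" where
  "tree_field T i =
     (\<chi> k. if (i, k) \<in> T then \<Prod>l\<in>{l. (l, i) \<in> T \<and> l \<noteq> i}. coord k - coord l else 0)"

context
  fixes T :: "'i::finite rel"
  assumes tree: "tree_order T"
begin

lemma tree_le_refl: "(i, i) \<in> T"
  using tree by (auto simp: tree_order_def partial_order_on_def preorder_on_def refl_on_def)

lemma tree_le_trans: "(i, j) \<in> T \<Longrightarrow> (j, k) \<in> T \<Longrightarrow> (i, k) \<in> T"
  using tree by (auto simp: tree_order_def partial_order_on_def preorder_on_def dest: transD)

lemma tree_le_antisym: "(i, j) \<in> T \<Longrightarrow> (j, i) \<in> T \<Longrightarrow> i = j"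
  using tree by (auto simp: tree_order_def partial_order_on_def dest: antisymD)

lemma tree_minimal_element:
  assumes "j \<in> S"
  shows "\<exists>i\<in>S. \<forall>k\<in>S. (k, i) \<in> T \<longrightarrow> k = i"
proof -
  have "finite (T - Id)" by simp
  moreover have "acyclic (T - Id)"
  proof -
    have "trans (T - Id)"
      by (rule transI) (auto intro: tree_le_trans dest: tree_le_antisym)
    then show ?thesis by (simp add: acyclic_irrefl irrefl_def)
  qed
  ultimately have "wf (T - Id)" by (rule finite_acyclic_wf)
  then obtain i where "i \<in> S" "\<forall>k. (k, i) \<in> T - Id \<longrightarrow> k \<notin> S"
    using assms unfolding wf_eq_minimal by meson
  then show ?thesis by blast
qed

text \<open>The definition of a tree order only speaks of intervals starting at the root. By
  finiteness, below every vertex lies a minimal one, which must be the root; so such an interval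
  contains all predecessors.\<close>

lemma predecessors_comparable:
  assumes "(i, k) \<in> T" "(j, k) \<in> T"
  shows "(i, j) \<in> T \<or> (j, i) \<in> T"
proof -
  obtain r where r: "minimal_vertex T r" and unique: "\<And>r'. minimal_vertex T r' \<Longrightarrow> r' = r"
    using tree unfolding tree_order_def by blast
  have root: "(r, l) \<in> T" for l
  proof -
    obtain m where m: "(m, l) \<in> T" "\<And>k. (k, l) \<in> T \<Longrightarrow> (k, m) \<in> T \<Longrightarrow> k = m"
      using tree_minimal_element[of l "{m. (m, l) \<in> T}"] tree_le_refl[of l] by auto
    then have "minimal_vertex T m"
      unfolding minimal_vertex_def using tree_le_trans by blast
    then show ?thesis using unique m by blast
  qed
  have "{l. (r, l) \<in> T \<and> (l, k) \<in> T} \<in> Chains T"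
    using tree r unfolding tree_order_def by blast
  then show ?thesis
    using root assms unfolding Chains_def by blast
qed

lemma mem_Der_iff:
  "\<theta> \<in> Der (tree_arrangement T) \<longleftrightarrow>
     (\<forall>i j. (i, j) \<in> T \<and> i \<noteq> j \<longrightarrow> coord i - coord j dvd \<theta> $ i - \<theta> $ j)"
  by (simp add: der_tree_arrangement vf_apply_diff_axis)

text \<open>Let \<open>j < k\<close>. If \<open>i\<close> is below both, the two coefficients are
  one polynomial evaluated at \<open>x_j\<close> and at \<open>x_k\<close>. If \<open>i\<close> is
  below \<open>k\<close> only, then \<open>j < i\<close> by comparability, so
  \<open>x_k - x_j\<close> is a factor of the coefficient at \<open>k\<close>. Otherwise both
  coefficients vanish.\<close>

lemma tree_field_mem_Der: "tree_field T i \<in> Der (tree_arrangement T)"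
  unfolding mem_Der_iff
proof (intro allI impI, elim conjE)
  fix j k assume jk: "(j, k) \<in> T" "j \<noteq> k"
  let ?A = "{l. (l, i) \<in> T \<and> l \<noteq> i}"
  consider "(i, j) \<in> T" "(i, k) \<in> T" | "(i, j) \<notin> T" "(i, k) \<in> T" | "(i, j) \<notin> T" "(i, k) \<notin> T"
    using jk tree_le_trans by blast
  then show "coord j - coord k dvd tree_field T i $ j - tree_field T i $ k"
  proof cases
    case 1
    have "coord j - coord k dvd (\<Prod>l\<in>?A. coord j - coord l) - (\<Prod>l\<in>?A. coord k - coord l)"
      by (rule prod_diff_dvd) simp
    with 1 show ?thesis by (simp add: tree_field_def)
  next
    case 2
    then have "j \<in> ?A" using predecessors_comparable jk tree_le_refl by blast
    then have "coord k - coord j dvd (\<Prod>l\<in>?A. coord k - coord l)"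
      by (intro dvd_prodI) simp_all
    then have "coord j - coord k dvd (\<Prod>l\<in>?A. coord k - coord l)"
      by (simp only: diff_dvd_swap[of "coord k"])
    with 2 show ?thesis by (simp add: tree_field_def)
  qed (simp add: tree_field_def)
qed

lemma tree_field_diag_mult_eq_0:
  assumes "p * tree_field T i $ i = 0"
  shows "p = 0"
  using prod_coord_diff_mult_eq_0[of i "{l. (l, i) \<in> T \<and> l \<noteq> i}" p] assms
  by (simp add: tree_field_def tree_le_refl mult.commute)

text \<open>Triangularity: at a minimal vertex \<open>m\<close> with \<open>u m\<close> nonzero,
  only the term of \<open>m\<close> contributes to the coefficient, and its diagonal entry can be
  cancelled.\<close>

lemma tree_field_combination_eq_0:
  assumes "(\<Sum>i\<in>UNIV. u i *s tree_field T i) = 0"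
  shows "u i = 0"
proof (rule ccontr)
  assume "u i \<noteq> 0"
  then obtain m where m: "u m \<noteq> 0" "\<And>k. u k \<noteq> 0 \<Longrightarrow> (k, m) \<in> T \<Longrightarrow> k = m"
    using tree_minimal_element[of i "{i. u i \<noteq> 0}"] by auto
  have "u k * tree_field T k $ m = (if k = m then u m * tree_field T m $ m else 0)" for k
    using m(2)[of k] by (cases "u k = 0") (auto simp: tree_field_def)
  then have "(\<Sum>k\<in>UNIV. u k * tree_field T k $ m) =
      (\<Sum>k\<in>UNIV. if k = m then u m * tree_field T m $ m else 0)"
    by (intro sum.cong refl)
  moreover have "(\<Sum>k\<in>UNIV. u k * tree_field T k $ m) = 0"
    using arg_cong[OF assms, of "\<lambda>\<theta>. \<theta> $ m"] by simp
  ultimately have "u m * tree_field T m $ m = 0" by simp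
  then show False using tree_field_diag_mult_eq_0 m(1) by blast
qed

text \<open>A basis is a set here, so vertices of equal depth must give distinct fields for the
  exponents to be counted with multiplicity.\<close>

lemma inj_tree_field: "inj (tree_field T)"
proof (rule injI, rule ccontr)
  fix i j assume ij: "tree_field T i = tree_field T j" "i \<noteq> j"
  let ?u = "\<lambda>k. if k = i then 1 else if k = j then - 1 else (0 :: 'i cpoly)"
  have "?u k *s tree_field T k =
      (if k = i then tree_field T i else 0) - (if k = j then tree_field T j else 0)" for k
    using ij(2) by auto
  then have "(\<Sum>k\<in>UNIV. ?u k *s tree_field T k) =
      (\<Sum>k\<in>UNIV. (if k = i then tree_field T i else 0) - (if k = j then tree_field T j else 0))"
    by (intro sum.cong refl)
  also have "\<dots> = 0"
    by (simp add: sum_subtractf ij(1))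
  finally have "?u i = 0"
    by (rule tree_field_combination_eq_0)
  then show False by simp
qed

lemma independent_tree_field: "vf.independent (range (tree_field T))"
proof -
  have "u (tree_field T i) = 0" if "(\<Sum>\<theta>\<in>range (tree_field T). u \<theta> *s \<theta>) = 0" for u i
  proof -
    have "(\<Sum>i\<in>UNIV. u (tree_field T i) *s tree_field T i) = 0"
      using that by (simp only: sum.reindex[OF inj_tree_field] o_def)
    then show ?thesis
      by (rule tree_field_combination_eq_0[of "\<lambda>i. u (tree_field T i)" i])
  qed
  then show ?thesis
    unfolding vf.dependent_finite[OF finite_imageI[OF finite]] by blast
qed

text \<open>The induction is on the size of the up-set generated by the support of
  \<open>\<theta>\<close>. The support itself need not shrink: subtracting a multiple of the field
  of \<open>i\<close> may create new nonzero coefficients above \<open>i\<close>, but these stay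
  within the up-set.\<close>

lemma Der_subset_span: "\<theta> \<in> Der (tree_arrangement T) \<Longrightarrow> \<theta> \<in> vf.span (range (tree_field T))"
proof (induction "card {k. \<exists>i. (i, k) \<in> T \<and> \<theta> $ i \<noteq> 0}" arbitrary: \<theta> rule: less_induct)
  case less
  define S where "S \<theta> = {k. \<exists>i. (i, k) \<in> T \<and> \<theta> $ i \<noteq> 0}" for \<theta> :: "'i vfield"
  show ?case
  proof (cases "\<theta> = 0")
    case False
    then obtain j where "\<theta> $ j \<noteq> 0" by (metis vec_eq_iff zero_index)
    then obtain i where i: "\<theta> $ i \<noteq> 0" "\<And>k. \<theta> $ k \<noteq> 0 \<Longrightarrow> (k, i) \<in> T \<Longrightarrow> k = i"
      using tree_minimal_element[of j "{i. \<theta> $ i \<noteq> 0}"] by auto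
    let ?A = "{l. (l, i) \<in> T \<and> l \<noteq> i}"
    have "coord i - coord l dvd \<theta> $ i" if "l \<in> ?A" for l
    proof -
      have "coord l - coord i dvd \<theta> $ l - \<theta> $ i"
        using less.prems that unfolding mem_Der_iff by blast
      moreover have "\<theta> $ l = 0" using i(2) that by blast
      ultimately show ?thesis by (simp add: diff_dvd_swap[of "coord i"])
    qed
    then have "(\<Prod>l\<in>?A. coord i - coord l) dvd \<theta> $ i"
      by (intro prod_coord_diff_dvd) auto
    then obtain f where f: "\<theta> $ i = f * tree_field T i $ i"
      by (auto simp: tree_field_def tree_le_refl dvd_def mult.commute)
    define \<eta> where "\<eta> = \<theta> - f *s tree_field T i"
    have "\<eta> \<in> Der (tree_arrangement T)"
      unfolding \<eta>_def using less.prems tree_field_mem_Der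
      by (intro vf.subspace_diff vf.subspace_scale subspace_Der)
    have \<eta>0: "\<eta> $ k = 0" if "\<theta> $ k = 0" "(i, k) \<notin> T" for k
      using that by (simp add: \<eta>_def tree_field_def)
    have "\<eta> $ i = 0" by (simp add: \<eta>_def f)
    have "S \<eta> \<subseteq> S \<theta>"
      unfolding S_def using \<eta>0 i(1) tree_le_trans by blast
    moreover have "i \<in> S \<theta>" using i(1) tree_le_refl unfolding S_def by blast
    \<comment> \<open>At a vertex strictly below \<open>i\<close>, \<open>\<theta>\<close> vanishes
      by minimality and the subtracted field by antisymmetry.\<close>
    moreover have "i \<notin> S \<eta>"
      unfolding S_def using \<open>\<eta> $ i = 0\<close> \<eta>0 i(2) tree_le_antisym by blast
    ultimately have "card (S \<eta>) < card (S \<theta>)"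
      by (intro psubset_card_mono) auto
    then have "\<eta> \<in> vf.span (range (tree_field T))"
      using less.hyps \<open>\<eta> \<in> Der (tree_arrangement T)\<close> unfolding S_def by blast
    moreover have "\<theta> = \<eta> + f *s tree_field T i" by (simp add: \<eta>_def)
    ultimately show ?thesis
      by (simp add: vf.span_add vf.span_base vf.span_scale)
  qed (simp add: vf.span_zero)
qed

lemma tree_field_basis: "is_basis_of (range (tree_field T)) (Der (tree_arrangement T))"
proof -
  have "vf.span (range (tree_field T)) \<subseteq> Der (tree_arrangement T)"
    using tree_field_mem_Der by (intro vf.span_minimal subspace_Der) auto
  then show ?thesis
    using independent_tree_field Der_subset_span unfolding is_basis_of_def by blast
qed

end

section \<open>Degrees of the fields and the exponents\<close>

lemma homogeneous_poly_coord_diff: "homogeneous_poly 1 (coord i - coord j)"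
proof -
  have "Poly_Mapping.keys (coord i - coord j) \<subseteq> {Poly_Mapping.single i 1, Poly_Mapping.single j 1}"
    using keys_diff[of "coord i" "coord j"] by (auto simp: coord_def)
  moreover have "(\<Sum>k\<in>UNIV. Poly_Mapping.lookup (Poly_Mapping.single l (1::nat)) k) = 1" for l :: 'a
    by (simp add: lookup_single when_def)
  ultimately show ?thesis by (auto simp: homogeneous_poly_def)
qed

lemma homogeneous_poly_mult:
  assumes "homogeneous_poly d p" "homogeneous_poly e q"
  shows "homogeneous_poly (d + e) (p * q)"
  unfolding homogeneous_poly_def
proof
  fix m assume "m \<in> Poly_Mapping.keys (p * q)"
  then obtain a b where "m = a + b" "a \<in> Poly_Mapping.keys p" "b \<in> Poly_Mapping.keys q"
    using keys_mult[of p q] by blast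
  then show "(\<Sum>i\<in>UNIV. Poly_Mapping.lookup m i) = d + e"
    using assms by (simp add: homogeneous_poly_def lookup_add sum.distrib)
qed

lemma homogeneous_poly_prod_coord_diff:
  "homogeneous_poly (card A) (\<Prod>l\<in>A. coord k - coord l)"
proof -
  have "finite A" by simp
  then show ?thesis
  proof (induction A)
    case empty
    then show ?case by (simp add: homogeneous_poly_def)
  next
    case (insert a A)
    then show ?case
      using homogeneous_poly_mult[OF homogeneous_poly_coord_diff insert.IH] by simp
  qed
qed

lemma homogeneous_tree_field: "homogeneous_vf (depth T i) (tree_field T i)"
  using homogeneous_poly_prod_coord_diff
  \<comment> \<open>The zero coefficients are homogeneous of every degree, as they have no
    monomials.\<close>
  by (auto simp: homogeneous_vf_def depth_def tree_field_def) (simp add: homogeneous_poly_def)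

theorem theorem1:
  fixes T :: "'i::finite rel"
  assumes "tree_order T"
  shows "free_arrangement (tree_arrangement T) \<and>
    (\<forall>M. has_exponents (tree_arrangement T) M \<longleftrightarrow> M = image_mset (depth T) (mset_set UNIV))"
proof (intro conjI allI)
  let ?B = "range (tree_field T)"
  \<comment> \<open>Degrees are assigned to fields, so the vertex is recovered from its field by
    injectivity.\<close>
  let ?d = "\<lambda>\<theta>. depth T (inv (tree_field T) \<theta>)"
  note basis = tree_field_basis[OF assms]
  have inj: "inj (tree_field T)" by (rule inj_tree_field[OF assms])
  then have hom: "homogeneous_vf (?d \<theta>) \<theta>" if "\<theta> \<in> ?B" for \<theta>
    using that homogeneous_tree_field by auto
  have "mset_set ?B = image_mset (tree_field T) (mset_set UNIV)"
    by (simp add: image_mset_mset_set inj)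
  then have M: "image_mset ?d (mset_set ?B) = image_mset (depth T) (mset_set UNIV)"
    by (simp add: multiset.map_comp o_def inj)
  show "free_arrangement (tree_arrangement T)"
    unfolding free_arrangement_def using basis by blast
  fix M
  show "has_exponents (tree_arrangement T) M \<longleftrightarrow> M = image_mset (depth T) (mset_set UNIV)"
  proof
    assume "has_exponents (tree_arrangement T) M"
    then obtain B d where B: "is_basis_of B (Der (tree_arrangement T))" "finite B"
        "\<And>\<theta>. \<theta> \<in> B \<Longrightarrow> homogeneous_vf (d \<theta>) \<theta>" and "M = image_mset d (mset_set B)"
      unfolding has_exponents_def by blast
    then show "M = image_mset (depth T) (mset_set UNIV)"
      using homogeneous_basis_degrees[OF B basis _ hom] M by simp
  next
    assume "M = image_mset (depth T) (mset_set UNIV)"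
    then show "has_exponents (tree_arrangement T) M"
      unfolding has_exponents_def
      by (intro exI[of _ ?B] exI[of _ ?d]) (use basis hom M in simp)
  qed
qed

end
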